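(* Let $X,Y$ be sets, let $f\colon X\to Y$ be a morphism in the Kleisli category $\mathcal{K}\ell(\mathcal{D})$ of the distribution monad $\mathcal{D}$ (i.e. a function $f\colon X\to\mathcal{D}(Y)$), and let $\phi\in[0,1]^{X\times Y}$ be a predicate. Then there are morphisms $f|\phi,\ f|\phi^{\perp}\colon X\to Y$ in $\mathcal{K}\ell(\mathcal{D})$ such that, in $\mathcal{K}\ell(\mathcal{D})$, $$\big((f|\phi)+(f|\phi^{\perp})\big)\odot \mathrm{char}_{\mathrm{gr}(f)^{\sharp}(\phi)} \;=\; (\pi_2+\pi_2)\odot \mathrm{char}_{\phi}\odot \mathrm{gr}(f)\colon\; X\to Y+Y .$$ If $\mathrm{gr}(f)^{\sharp}(\phi)(x)\in(0,1)$ for each $x\in X$, then both maps $f|\phi$ and $f|\phi^{\perp}$ are uniquely determined by this equation.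
   Context: For a set $X$, $\mathcal{D}(X)$ is the set of finitely supported probability distributions on $X$, written as formal finite convex sums $\sum_i r_i|x_i\rangle$ with $x_i\in X$, $r_i\in[0,1]$, $\sum_i r_i=1$. This is a monad on sets with unit $\eta(x)=1|x\rangle$ and multiplication $\mu(\sum_i r_i|\varphi_i\rangle)=\sum_{i,j}r_is_{ij}|x_{ij}\rangle$ for $\varphi_i=\sum_j s_{ij}|x_{ij}\rangle$. The Kleisli category $\mathcal{K}\ell(\mathcal{D})$ has sets as objects; a morphism $X\to Y$ is a function $X\to\mathcal{D}(Y)$; composition is $(g\odot f)(x)=\sum_{i,j}r_is_{ij}|z_{ij}\rangle$ if $f(x)=\sum_i r_i|y_i\rangle$ and $g(y_i)=\sum_j s_{ij}|z_{ij}\rangle$. The coproduct $X+Y$ in $\mathcal{K}\ell(\mathcal{D})$ is the disjoint union of sets, with coprojections $\eta\circ\kappa_i$, where $\kappa_1,\kappa_2$ are the coprojections of sets. For Kleisli maps $g_1,g_2\colon X\to Y$ the map $g_1+g_2\colon X+X\to Y+Y$ sends $\kappa_i x$ to $\mathcal{D}(\kappa_i)(g_i(x))$. The projection $\pi_2\colon X\times Y\to Y$ in $\mathcal{K}\ell(\mathcal{D})$ is $(x,y)\mapsto 1|y\rangle$. The graph of $f\colon X\to\mathcal{D}(Y)$ is the Kleisli map $\mathrm{gr}(f)\colon X\to X\times Y$ given by $\mathrm{gr}(f)(x)=\sum_i r_i|(x,y_i)\rangle$ if $f(x)=\sum_i r_i|y_i\rangle$. A predicate on a set $X$ is a function $p\in[0,1]^X$;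 $p^{\perp}(x)=1-p(x)$. For a Kleisli map $h\colon X\to Z$ and a predicate $q\in[0,1]^Z$, substitution is the predicate $h^{\sharp}(q)\in[0,1]^X$, $h^{\sharp}(q)(x)=\sum_i r_i\, q(z_i)$ if $h(x)=\sum_i r_i|z_i\rangle$. The characteristic map of $p\in[0,1]^X$ is the Kleisli map $\mathrm{char}_p\colon X\to X+X$, $\mathrm{char}_p(x)=p(x)|\kappa_1x\rangle+(1-p(x))|\kappa_2x\rangle$. *)

theory Defs
  imports "HOL-Probability.Probability_Mass_Function" "HOL-Library.FuncSet"
begin

text \<open>
  Sets are carriers inside a type, so that empty sets are covered. A function on a carrier is
  extensional (undefined outside the carrier), so that equality of morphisms
  is equality on the carrier. The set of predicates on \<open>X\<close> is then \<open>X \<rightarrow>\<^sub>E {0..1}\<close>, and the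
  coproduct object of \<open>X\<close> and \<open>Y\<close> is the disjoint union \<open>X <+> Y\<close>.
\<close>

definition fdist :: "'a set \<Rightarrow> 'a pmf set" where
  "fdist X = {p. finite (set_pmf p) \<and> set_pmf p \<subseteq> X}"

definition kleisli :: "'a set \<Rightarrow> 'b set \<Rightarrow> ('a \<Rightarrow> 'b pmf) set" where
  "kleisli X Y = X \<rightarrow>\<^sub>E fdist Y"

text \<open>In \<open>kcomp X g f\<close>, \<open>X\<close> is the domain of \<open>f\<close>; likewise in the other operations below the set
  arguments only serve to restrict the result to its domain.\<close>

definition kcomp :: "'a set \<Rightarrow> ('b \<Rightarrow> 'c pmf) \<Rightarrow> ('a \<Rightarrow> 'b pmf) \<Rightarrow> 'a \<Rightarrow> 'c pmf" where
  "kcomp X g f = (\<lambda>x\<in>X. bind_pmf (f x) g)"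

definition kplus ::
  "'a set \<Rightarrow> ('a \<Rightarrow> 'b pmf) \<Rightarrow> ('a \<Rightarrow> 'b pmf) \<Rightarrow> 'a + 'a \<Rightarrow> ('b + 'b) pmf" where
  "kplus X g1 g2 =
     (\<lambda>s\<in>X <+> X. case s of Inl x \<Rightarrow> map_pmf Inl (g1 x) | Inr x \<Rightarrow> map_pmf Inr (g2 x))"

definition kproj2 :: "'a set \<Rightarrow> 'b set \<Rightarrow> 'a \<times> 'b \<Rightarrow> 'b pmf" where
  "kproj2 X Y = (\<lambda>z\<in>X \<times> Y. return_pmf (snd z))"

definition kgraph :: "'a set \<Rightarrow> ('a \<Rightarrow> 'b pmf) \<Rightarrow> 'a \<Rightarrow> ('a \<times> 'b) pmf" where
  "kgraph X f = (\<lambda>x\<in>X. map_pmf (Pair x) (f x))"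

definition ksubst :: "'a set \<Rightarrow> ('a \<Rightarrow> 'b pmf) \<Rightarrow> ('b \<Rightarrow> real) \<Rightarrow> 'a \<Rightarrow> real" where
  "ksubst X h q = (\<lambda>x\<in>X. \<Sum>z\<in>set_pmf (h x). pmf (h x) z * q z)"

definition kchar :: "'a set \<Rightarrow> ('a \<Rightarrow> real) \<Rightarrow> 'a \<Rightarrow> ('a + 'a) pmf" where
  "kchar X p = (\<lambda>x\<in>X. map_pmf (\<lambda>b. if b then Inl x else Inr x) (bernoulli_pmf (p x)))"

lemma pmf_kcomp:
  assumes "f \<in> kleisli X Y" "x \<in> X"
  shows "pmf (kcomp X g f x) z = (\<Sum>y\<in>set_pmf (f x). pmf (f x) y * pmf (g y) z)"
proof -
  have "finite (set_pmf (f x))"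
    using assms by (auto simp: kleisli_def fdist_def PiE_def Pi_def)
  then show ?thesis
    using assms(2) by (simp add: kcomp_def pmf_bind integral_measure_pmf_real[of "set_pmf (f x)"] mult.commute)
qed

lemma pmf_kchar:
  assumes "p \<in> X \<rightarrow>\<^sub>E {0..1}" "x \<in> X"
  shows "pmf (kchar X p x) (Inl y) = (if y = x then p x else 0)"
    and "pmf (kchar X p x) (Inr y) = (if y = x then 1 - p x else 0)"
proof -
  have p: "0 \<le> p x" "p x \<le> 1"
    using assms by (auto simp: PiE_def Pi_def)
  have l: "(\<lambda>b. if b then Inl x else Inr x) -` {Inl y} = (if y = x then {True} else {})"
    and r: "(\<lambda>b. if b then Inl x else Inr x) -` {Inr y} = (if y = x then {False} else {})"
    for y :: 'a
    by (auto split: if_splits)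
  show "pmf (kchar X p x) (Inl y) = (if y = x then p x else 0)"
    and "pmf (kchar X p x) (Inr y) = (if y = x then 1 - p x else 0)"
    using p assms(2) by (simp_all add: kchar_def pmf_map l r measure_pmf_single)
qed

lemma kcomp_in_kleisli:
  assumes "f \<in> kleisli X Y" "g \<in> kleisli Y Z"
  shows "kcomp X g f \<in> kleisli X Z"
  using assms by (fastforce simp: kleisli_def fdist_def kcomp_def PiE_iff)

lemma kplus_in_kleisli:
  assumes "g1 \<in> kleisli X Y" "g2 \<in> kleisli X Y"
  shows "kplus X g1 g2 \<in> kleisli (X <+> X) (Y <+> Y)"
  using assms by (fastforce simp: kleisli_def fdist_def kplus_def PiE_iff)

lemma kproj2_in_kleisli: "kproj2 X Y \<in> kleisli (X \<times> Y) Y"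
  by (auto simp: kleisli_def fdist_def kproj2_def)

lemma kgraph_in_kleisli:
  assumes "f \<in> kleisli X Y"
  shows "kgraph X f \<in> kleisli X (X \<times> Y)"
  using assms by (fastforce simp: kleisli_def fdist_def kgraph_def PiE_iff)

lemma kchar_in_kleisli: "kchar X p \<in> kleisli X (X <+> X)"
  by (auto simp: kleisli_def fdist_def kchar_def)

lemma ksubst_in_predicates:
  assumes "h \<in> kleisli X Z" "q \<in> Z \<rightarrow>\<^sub>E {0..1}"
  shows "ksubst X h q \<in> X \<rightarrow>\<^sub>E {0..1}"
proof -
  have "(\<Sum>z\<in>set_pmf (h x). pmf (h x) z * q z) \<in> {0..1}" if "x \<in> X" for x
  proof -
    have fin: "finite (set_pmf (h x))" and sub: "set_pmf (h x) \<subseteq> Z"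
      using assms(1) \<open>x \<in> X\<close> by (auto simp: kleisli_def fdist_def PiE_iff)
    have q: "0 \<le> q z \<and> q z \<le> 1" if "z \<in> set_pmf (h x)" for z
      using that sub assms(2) by (auto simp: PiE_iff)
    have "(\<Sum>z\<in>set_pmf (h x). pmf (h x) z * q z) \<le> (\<Sum>z\<in>set_pmf (h x). pmf (h x) z)"
      using q by (intro sum_mono) (simp add: mult_left_le)
    also have "\<dots> = 1"
      using fin by (simp add: sum_pmf_eq_1)
    finally show ?thesis
      using q by (simp add: sum_nonneg)
  qed
  then show ?thesis
    by (simp add: ksubst_def PiE_iff)
qed

end

theory Submission
  imports Defs
begin

text \<open>At \<open>x\<close>, the two composites have masses \<open>w x * g1 x y\<close> and \<open>f x y * \<phi> (x, y)\<close> at \<open>Inl y\<close>,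
  and masses \<open>(1 - w x) * g2 x y\<close> and \<open>f x y * (1 - \<phi> (x, y))\<close> at \<open>Inr y\<close>, where
  \<open>w x = (\<Sum>y. f x y * \<phi> (x, y))\<close>. So \<open>g1\<close> and \<open>g2\<close> are the normalisations of \<open>f\<close> reweighted by
  \<open>\<phi>\<close> and by \<open>1 - \<phi>\<close>; they are arbitrary exactly where \<open>w x\<close> is \<open>0\<close> or \<open>1\<close>, respectively.\<close>

lemma ex_reweighted_pmf:
  fixes q :: "'b \<Rightarrow> real"
  assumes p: "p \<in> fdist Y" and q: "\<And>y. y \<in> set_pmf p \<Longrightarrow> 0 \<le> q y"
  shows "\<exists>g\<in>fdist Y. \<forall>y. (\<Sum>z\<in>set_pmf p. pmf p z * q z) * pmf g y = pmf p y * q y"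
proof -
  define s where "s = (\<Sum>z\<in>set_pmf p. pmf p z * q z)"
  have fin: "finite (set_pmf p)" and sub: "set_pmf p \<subseteq> Y"
    using p by (auto simp: fdist_def)
  have nonneg: "0 \<le> pmf p y * q y" for y
    using q by (cases "y \<in> set_pmf p") (auto simp: set_pmf_iff)
  show ?thesis
  proof (cases "s = 0")
    case True
    \<comment> \<open>A vanishing sum of nonnegative terms forces every reweighted mass to be
      \<open>0\<close>. The required equation then reads \<open>0 = 0\<close>, so any distribution
      on \<open>Y\<close> would do; \<open>p\<close> is one at hand.\<close>
    then have 0: "pmf p y * q y = 0" for y
      using fin nonneg by (cases "y \<in> set_pmf p") (auto simp: s_def sum_nonneg_eq_0_iff set_pmf_iff)
    show ?thesis
      using p by (intro bexI[of _ p]) (simp_all only: 0 sum.neutral_const mult_zero_left simp_thms)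
  next
    case False
    then have s: "0 < s"
      using nonneg by (simp add: s_def sum_nonneg order_less_le)
    define d where "d y = pmf p y * q y / s" for y
    have d0: "0 \<le> d y" for y
      using nonneg s by (simp add: d_def)
    \<comment> \<open>To be the mass function of a \<open>pmf\<close>, \<open>d\<close> must
      integrate to 1 over the whole type. It vanishes off the finite support of \<open>p\<close>, so
      a finite sum suffices.\<close>
    have "(\<integral>\<^sup>+ y. ennreal (d y) \<partial>count_space UNIV) = (\<Sum>y\<in>set_pmf p. ennreal (d y))"
      using fin by (intro nn_integral_count_space') (auto simp: d_def set_pmf_iff)
    also have "\<dots> = ennreal (\<Sum>y\<in>set_pmf p. d y)"
      using d0 by (rule sum_ennreal)
    also have "(\<Sum>y\<in>set_pmf p. d y) = 1"
      using s by (simp add: d_def s_def flip: sum_divide_distrib)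
    finally have d: "pmf (embed_pmf d) y = d y" for y
      using d0 by (intro pmf_embed_pmf) auto
    have "set_pmf (embed_pmf d) \<subseteq> set_pmf p"
      by (auto simp: set_pmf_iff d d_def)
    then have "embed_pmf d \<in> fdist Y"
      using fin sub finite_subset by (auto simp: fdist_def)
    moreover have "s * pmf (embed_pmf d) y = pmf p y * q y" for y
      using s by (simp add: d d_def)
    ultimately show ?thesis
      unfolding s_def by blast
  qed
qed

text \<open>Pointwise choice from the previous lemma. The weight \<open>q\<close> is general so that
  both \<phi> and its complement can be inserted.\<close>

lemma kleisli_reweighted:
  fixes q :: "'a \<Rightarrow> 'b \<Rightarrow> real"
  assumes f: "f \<in> kleisli X Y"
    and q: "\<And>x y. x \<in> X \<Longrightarrow> y \<in> set_pmf (f x) \<Longrightarrow> 0 \<le> q x y"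
  shows "\<exists>g\<in>kleisli X Y. \<forall>x\<in>X. \<forall>y.
    (\<Sum>z\<in>set_pmf (f x). pmf (f x) z * q x z) * pmf (g x) y = pmf (f x) y * q x y"
proof -
  have "\<forall>x\<in>X. \<exists>g. g \<in> fdist Y \<and>
      (\<forall>y. (\<Sum>z\<in>set_pmf (f x). pmf (f x) z * q x z) * pmf g y = pmf (f x) y * q x y)"
  proof
    fix x assume x: "x \<in> X"
    then have "f x \<in> fdist Y"
      using f by (auto simp: kleisli_def)
    from ex_reweighted_pmf[OF this, of "q x"] q[OF x]
    show "\<exists>g. g \<in> fdist Y \<and>
      (\<forall>y. (\<Sum>z\<in>set_pmf (f x). pmf (f x) z * q x z) * pmf g y = pmf (f x) y * q x y)"
      by blast
  qed
  then obtain g where "\<forall>x\<in>X. g x \<in> fdist Y \<and>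
      (\<forall>y. (\<Sum>z\<in>set_pmf (f x). pmf (f x) z * q x z) * pmf (g x) y = pmf (f x) y * q x y)"
    by metis
  then show ?thesis
    \<comment> \<open>The chosen function is arbitrary outside \<open>X\<close>; restricting it
      makes it extensional.\<close>
    by (intro bexI[of _ "restrict g X"]) (auto simp: kleisli_def)
qed

text \<open>\<open>kchar\<close> tosses a coin of bias \<open>p x\<close> and records the outcome in
  the tag, which \<open>kplus\<close> preserves; hence only one branch contributes to each side of
  the sum. The lemma serves both composites: it is also applied over \<open>X \<times> Y\<close> to
  the projections.\<close>

lemma pmf_kcomp_kplus_kchar:
  assumes "x \<in> X" "p x \<in> {0..1}"
  shows "pmf (kcomp X (kplus X g1 g2) (kchar X p) x) (Inl y) = p x * pmf (g1 x) y"
    and "pmf (kcomp X (kplus X g1 g2) (kchar X p) x) (Inr y) = (1 - p x) * pmf (g2 x) y"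
proof -
  have inj: "pmf (map_pmf Inl q) (Inl y) = pmf q y" "pmf (map_pmf Inr q) (Inr y) = pmf q y"
    "pmf (map_pmf Inr q) (Inl y) = 0" "pmf (map_pmf Inl q) (Inr y) = 0" for q :: "'b pmf"
    by (auto simp: pmf_map_inj' pmf_eq_0_set_pmf)
  show "pmf (kcomp X (kplus X g1 g2) (kchar X p) x) (Inl y) = p x * pmf (g1 x) y"
    and "pmf (kcomp X (kplus X g1 g2) (kchar X p) x) (Inr y) = (1 - p x) * pmf (g2 x) y"
    using assms by (simp_all add: kcomp_def kchar_def kplus_def bind_map_pmf pmf_bind inj InlI InrI)
qed

lemma pmf_kcomp_kproj2_kchar_kgraph:
  assumes f: "f \<in> kleisli X Y" and \<phi>: "\<phi> \<in> X \<times> Y \<rightarrow>\<^sub>E {0..1}" and x: "x \<in> X"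
  defines "r \<equiv> kcomp X (kplus (X \<times> Y) (kproj2 X Y) (kproj2 X Y))
    (kcomp X (kchar (X \<times> Y) \<phi>) (kgraph X f)) x"
  shows "pmf r (Inl y) = pmf (f x) y * \<phi> (x, y)"
    and "pmf r (Inr y) = pmf (f x) y * (1 - \<phi> (x, y))"
proof -
  let ?h = "kcomp (X \<times> Y) (kplus (X \<times> Y) (kproj2 X Y) (kproj2 X Y)) (kchar (X \<times> Y) \<phi>)"
  have sub: "set_pmf (f x) \<subseteq> Y"
    using f x by (auto simp: kleisli_def fdist_def PiE_iff)
  \<comment> \<open>Reassociating puts the coin toss and the projections together in
    \<open>?h\<close>, leaving an average over \<open>f x\<close>. The support of \<open>f x\<close>
    lies in \<open>Y\<close>, so \<open>?h\<close> is only evaluated inside its domain.\<close>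
  have "r = bind_pmf (f x) (\<lambda>z. ?h (x, z))"
    unfolding r_def using x sub
    by (auto simp: kcomp_def kgraph_def bind_assoc_pmf bind_map_pmf intro!: bind_pmf_cong)
  then have r: "pmf r t = measure_pmf.expectation (f x) (\<lambda>z. pmf (?h (x, z)) t)" for t
    by (simp add: pmf_bind)
  \<comment> \<open>The projection leaves only the term with \<open>z = y\<close>, so the value can
    be written with \<phi> at \<open>(x, y)\<close>, a constant not depending on
    \<open>z\<close>.\<close>
  have h: "pmf (?h (x, z)) (Inl y) = (if z = y then \<phi> (x, y) else 0)"
    "pmf (?h (x, z)) (Inr y) = (if z = y then 1 - \<phi> (x, y) else 0)" if "z \<in> set_pmf (f x)" for z
  proof -
    have "(x, z) \<in> X \<times> Y" and "\<phi> (x, z) \<in> {0..1}"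
      using that sub x \<phi> by (auto simp: PiE_iff)
    then show "pmf (?h (x, z)) (Inl y) = (if z = y then \<phi> (x, y) else 0)"
      "pmf (?h (x, z)) (Inr y) = (if z = y then 1 - \<phi> (x, y) else 0)"
      by (simp_all add: pmf_kcomp_kplus_kchar kproj2_def)
  qed
  have expect: "measure_pmf.expectation (f x) u = pmf (f x) y * c"
    if u: "\<And>z. z \<in> set_pmf (f x) \<Longrightarrow> u z = (if z = y then c else 0)" for u :: "'b \<Rightarrow> real" and c
  proof -
    have "measure_pmf.expectation (f x) u = (\<Sum>z\<in>{y}. u z * pmf (f x) z)"
      by (rule integral_measure_pmf_real) (auto simp: u split: if_splits)
    then show ?thesis
      \<comment> \<open>If \<open>y\<close> is outside the support, nothing is known about
        \<open>u y\<close>, but its factor \<open>pmf (f x) y\<close> is \<open>0\<close>.\<close>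
      using u[of y] by (cases "y \<in> set_pmf (f x)") (auto simp: set_pmf_iff)
  qed
  show "pmf r (Inl y) = pmf (f x) y * \<phi> (x, y)"
    unfolding r by (rule expect) (rule h)
  show "pmf r (Inr y) = pmf (f x) y * (1 - \<phi> (x, y))"
    unfolding r by (rule expect) (rule h)
qed

lemma ksubst_kgraph:
  assumes "x \<in> X"
  shows "ksubst X (kgraph X f) \<phi> x = (\<Sum>y\<in>set_pmf (f x). pmf (f x) y * \<phi> (x, y))"
  using assms
  by (simp add: ksubst_def kgraph_def sum.reindex inj_on_def pmf_map_inj')

text \<open>Since \<open>f x\<close> has total mass 1, the normalising constant for the
  complementary predicate is the complement of the one for \<phi>.\<close>

lemma one_minus_ksubst_kgraph:
  assumes "f \<in> kleisli X Y" "x \<in> X"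
  shows "1 - ksubst X (kgraph X f) \<phi> x = (\<Sum>y\<in>set_pmf (f x). pmf (f x) y * (1 - \<phi> (x, y)))"
proof -
  have "finite (set_pmf (f x))"
    using assms by (auto simp: kleisli_def fdist_def PiE_iff)
  then have "(\<Sum>y\<in>set_pmf (f x). pmf (f x) y) = 1"
    by (simp add: sum_pmf_eq_1)
  then show ?thesis
    using assms(2) by (simp add: ksubst_kgraph right_diff_distrib sum_subtractf)
qed

lemma pmf_sum_eq_iff:
  fixes p q :: "('a + 'b) pmf"
  shows "p = q \<longleftrightarrow> (\<forall>y. pmf p (Inl y) = pmf q (Inl y)) \<and> (\<forall>y. pmf p (Inr y) = pmf q (Inr y))"
  by (metis pmf_eqI sumE)

text \<open>Comparing masses on the two summands decouples the equation into one linear condition on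
  \<open>g1\<close> and one on \<open>g2\<close>. Existence and uniqueness are both read off from
  these.\<close>

lemma kleisli_split_iff:
  fixes f :: "'a \<Rightarrow> 'b pmf"
  assumes f: "f \<in> kleisli X Y" and \<phi>: "\<phi> \<in> X \<times> Y \<rightarrow>\<^sub>E {0..1}"
  defines "w \<equiv> ksubst X (kgraph X f) \<phi>"
  shows "kcomp X (kplus X g1 g2) (kchar X w) =
      kcomp X (kplus (X \<times> Y) (kproj2 X Y) (kproj2 X Y)) (kcomp X (kchar (X \<times> Y) \<phi>) (kgraph X f)) \<longleftrightarrow>
    (\<forall>x\<in>X. \<forall>y. w x * pmf (g1 x) y = pmf (f x) y * \<phi> (x, y)) \<and>
    (\<forall>x\<in>X. \<forall>y. (1 - w x) * pmf (g2 x) y = pmf (f x) y * (1 - \<phi> (x, y)))"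
    (is "?l = ?r \<longleftrightarrow> _")
proof -
  have w: "w x \<in> {0..1}" if "x \<in> X" for x
    using ksubst_in_predicates[OF kgraph_in_kleisli[OF f] \<phi>] that unfolding w_def by (rule PiE_mem)
  \<comment> \<open>Both composites are \<open>undefined\<close> outside \<open>X\<close>, so they
    can differ only on \<open>X\<close>.\<close>
  have "?l = ?r \<longleftrightarrow> (\<forall>x\<in>X. ?l x = ?r x)"
  proof
    assume "\<forall>x\<in>X. ?l x = ?r x"
    then show "?l = ?r"
      by (intro extensionalityI[of _ X]) (auto simp: kcomp_def)
  qed simp
  then show ?thesis
    by (simp add: pmf_sum_eq_iff pmf_kcomp_kplus_kchar w
        pmf_kcomp_kproj2_kchar_kgraph[OF f \<phi>] ball_conj_distrib del: atLeastAtMost_iff cong: ball_cong)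
qed

lemma kleisli_eqI:
  assumes "g \<in> kleisli X Y" "h \<in> kleisli X Y" "\<And>x y. x \<in> X \<Longrightarrow> pmf (g x) y = pmf (h x) y"
  shows "g = h"
  using assms by (intro PiE_ext[of g X "\<lambda>_. fdist Y"]) (auto simp: kleisli_def intro: pmf_eqI)

theorem theorem4:
  fixes X :: "'a set" and Y :: "'b set"
    and f :: "'a \<Rightarrow> 'b pmf" and \<phi> :: "'a \<times> 'b \<Rightarrow> real"
  assumes f: "f \<in> kleisli X Y"
    and \<phi>: "\<phi> \<in> X \<times> Y \<rightarrow>\<^sub>E {0..1}"
  shows
    "let is_split = (\<lambda>g1 g2.
           kcomp X (kplus X g1 g2) (kchar X (ksubst X (kgraph X f) \<phi>)) =
           kcomp X (kplus (X \<times> Y) (kproj2 X Y) (kproj2 X Y))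
             (kcomp X (kchar (X \<times> Y) \<phi>) (kgraph X f)))
     in (\<exists>g1\<in>kleisli X Y. \<exists>g2\<in>kleisli X Y. is_split g1 g2) \<and>
        ((\<forall>x\<in>X. ksubst X (kgraph X f) \<phi> x \<in> {0<..<1}) \<longrightarrow>
          (\<exists>!g. g \<in> kleisli X Y \<times> kleisli X Y \<and> is_split (fst g) (snd g)))"
proof -
  define w where "w = ksubst X (kgraph X f) \<phi>"
  define is_split where "is_split g1 g2 \<longleftrightarrow>
    kcomp X (kplus X g1 g2) (kchar X w) =
    kcomp X (kplus (X \<times> Y) (kproj2 X Y) (kproj2 X Y)) (kcomp X (kchar (X \<times> Y) \<phi>) (kgraph X f))"
    for g1 g2 :: "'a \<Rightarrow> 'b pmf"
  have split_iff: "is_split g1 g2 \<longleftrightarrow>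
    (\<forall>x\<in>X. \<forall>y. w x * pmf (g1 x) y = pmf (f x) y * \<phi> (x, y)) \<and>
    (\<forall>x\<in>X. \<forall>y. (1 - w x) * pmf (g2 x) y = pmf (f x) y * (1 - \<phi> (x, y)))" for g1 g2
    unfolding is_split_def w_def by (rule kleisli_split_iff[OF f \<phi>])
  have \<phi>01: "0 \<le> \<phi> (x, y)" "0 \<le> 1 - \<phi> (x, y)" if "x \<in> X" "y \<in> set_pmf (f x)" for x y
  proof -
    have "y \<in> Y"
      using f that by (auto simp: kleisli_def fdist_def PiE_iff)
    then show "0 \<le> \<phi> (x, y)" "0 \<le> 1 - \<phi> (x, y)"
      using \<phi> that(1) by (auto simp: PiE_iff)
  qed
  obtain g1 where g1: "g1 \<in> kleisli X Y"
    and "\<forall>x\<in>X. \<forall>y. w x * pmf (g1 x) y = pmf (f x) y * \<phi> (x, y)"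
    using kleisli_reweighted[OF f, of "\<lambda>x y. \<phi> (x, y)"] \<phi>01(1)
    by (auto simp: w_def ksubst_kgraph)
  moreover obtain g2 where g2: "g2 \<in> kleisli X Y"
    and "\<forall>x\<in>X. \<forall>y. (1 - w x) * pmf (g2 x) y = pmf (f x) y * (1 - \<phi> (x, y))"
    using kleisli_reweighted[OF f, of "\<lambda>x y. 1 - \<phi> (x, y)"] \<phi>01(2)
    by (auto simp: w_def one_minus_ksubst_kgraph[OF f])
  ultimately have split: "is_split g1 g2"
    by (simp add: split_iff)
  have unique: "h1 = g1 \<and> h2 = g2"
    if w: "\<forall>x\<in>X. w x \<in> {0<..<1}" and h: "h1 \<in> kleisli X Y" "h2 \<in> kleisli X Y" "is_split h1 h2"
    for h1 h2
  proof -
    have "w x * pmf (h1 x) y = w x * pmf (g1 x) y"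
      and "(1 - w x) * pmf (h2 x) y = (1 - w x) * pmf (g2 x) y" if "x \<in> X" for x y
      using split h(3) that by (simp_all add: split_iff)
    \<comment> \<open>Cancelling in the first equation needs \<open>w x > 0\<close>, in the second
      \<open>w x < 1\<close>.\<close>
    then have "pmf (h1 x) y = pmf (g1 x) y" and "pmf (h2 x) y = pmf (g2 x) y" if "x \<in> X" for x y
      using w that by force+
    with h g1 g2 show ?thesis
      by (blast intro: kleisli_eqI)
  qed
  show ?thesis
    unfolding Let_def w_def[symmetric] is_split_def[symmetric]
  proof (intro conjI impI)
    show "\<exists>g1\<in>kleisli X Y. \<exists>g2\<in>kleisli X Y. is_split g1 g2"
      using g1 g2 split by blast
    assume w: "\<forall>x\<in>X. w x \<in> {0<..<1}"
    show "\<exists>!g. g \<in> kleisli X Y \<times> kleisli X Y \<and> is_split (fst g) (snd g)"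
    proof (rule ex1I[of _ "(g1, g2)"])
      show "(g1, g2) \<in> kleisli X Y \<times> kleisli X Y \<and> is_split (fst (g1, g2)) (snd (g1, g2))"
        using g1 g2 split by simp
      show "h = (g1, g2)" if "h \<in> kleisli X Y \<times> kleisli X Y \<and> is_split (fst h) (snd h)" for h
        using unique[OF w, of "fst h" "snd h"] that by (simp add: prod_eq_iff mem_Times_iff)
    qed
  qed
qed

end
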